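(* For any $\Delta>0$ and $w,z\in\mathbb{C}$, \[ K_{\mathrm{O},\pi\Delta}(w,z) = \frac{\sin\pi\Delta(z-\overline{w})}{\pi(z-\overline{w})} - \frac{1}{2 + \Delta} \left(\frac{\sin\pi\Delta z}{\pi z}\right) \left( \frac{\sin\pi\Delta \overline{w} }{\pi \overline{w}}\right). \]
   Context: $W_{\mathrm O}(x)=1+\frac12\boldsymbol{\delta}_0(x)$, with $\boldsymbol{\delta}_0$ the Dirac delta at $0$. For $\Delta>0$, $\mathcal{H}_{\mathrm O,\pi\Delta}$ is the Hilbert space of entire functions $F$ of exponential type at most $\pi\Delta$ with $\int_{\mathbb{R}}|F(x)|^2dx+\frac12|F(0)|^2<\infty$, with inner product $\langle F,H\rangle=\int_{\mathbb{R}}F(x)\overline{H(x)}\,dx+\frac12F(0)\overline{H(0)}$. Its reproducing kernel $K_{\mathrm O,\pi\Delta}$ is the unique function on $\mathbb{C}\times\mathbb{C}$ such that for each $w$, $K_{\mathrm O,\pi\Delta}(w,\cdot)\in\mathcal{H}_{\mathrm O,\pi\Delta}$ and $F(w)=\langle F,K_{\mathrm O,\pi\Delta}(w,\cdot)\rangle$ for all $F$ in the space. Expressions like $\frac{\sin \pi\Delta z}{\pi z}$ are interpreted by continuity ($=\Delta$) at $z=0$. *)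

theory Defs
  imports "HOL-Analysis.Analysis"
begin

definition exp_type_le :: "real \<Rightarrow> (complex \<Rightarrow> complex) \<Rightarrow> bool" where
  "exp_type_le tau F \<longleftrightarrow>
     (\<forall>\<epsilon>>0. \<exists>C. \<forall>z. norm (F z) \<le> C * exp ((tau + \<epsilon>) * norm z))"

text \<open>The space H_{O, pi Delta}: entire functions of exponential type at most pi Delta
  with finite norm (the point mass term 1/2 |F(0)|^2 is always finite).\<close>
definition HO :: "real \<Rightarrow> (complex \<Rightarrow> complex) set" where
  "HO Delta = {F. F holomorphic_on UNIV \<and> exp_type_le (pi * Delta) F \<and>
                  integrable lborel (\<lambda>x::real. (norm (F (complex_of_real x)))\<^sup>2)}"

text \<open>Inner product with respect to the measure 1 + (1/2) delta_0.\<close>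
definition HO_inner :: "(complex \<Rightarrow> complex) \<Rightarrow> (complex \<Rightarrow> complex) \<Rightarrow> complex" where
  "HO_inner F H = (LINT x|lborel. F (complex_of_real x) * cnj (H (complex_of_real x)))
                  + 1/2 * F 0 * cnj (H 0)"

definition KO :: "real \<Rightarrow> complex \<Rightarrow> complex \<Rightarrow> complex" where
  "KO Delta = (THE K. (\<forall>w. K w \<in> HO Delta) \<and>
                      (\<forall>w. \<forall>F\<in>HO Delta. F w = HO_inner F (K w)))"

text \<open>sin(pi Delta z)/(pi z), extended by continuity (value Delta) at z = 0.\<close>
definition sincD :: "real \<Rightarrow> complex \<Rightarrow> complex" where
  "sincD Delta z = (if z = 0 then complex_of_real Delta
                    else sin (complex_of_real (pi * Delta) * z) / (complex_of_real pi * z))"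

end

theory Submission
  imports Defs
    "HOL-Complex_Analysis.Complex_Analysis"
    "HOL-Probability.Sinc_Integral"
    "HOL-Real_Asymp.Real_Asymp"
begin

text \<open>
  The Paley--Wiener space (no point mass) has kernel $\sin \pi\Delta(z-\bar w)/\pi(z-\bar w)$; a
  rank-one correction then absorbs the mass at $0$. For $F$ in the space, $F^2$ is integrable on the
  real line, so its primitive is bounded there; Phragmen--Lindelof and Cauchy's inequality turn this
  into $|F(z)| \le M e^{\pi\Delta|\Im z|}$. For $\sigma > \Delta$ the functions
  $F(z) e^{\pm i\pi\sigma(z-w)}$ therefore decay in the upper and lower half plane respectively, so
  splitting $\sin \pi\sigma(z-w)$ into exponentials and closing the contour in these half planes
  gives the formula with $\sigma$ in place of $\Delta$. Finally $\sigma \to \Delta$ by dominated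
  convergence.
\<close>

subsection \<open>Phragmen--Lindelof principles\<close>

lemma interior_halfspace_Re_ge: "interior {z. Re z \<ge> b} = {z. Re z > b}"
  using interior_halfspace_ge[of "1 :: complex" b] by (simp add: inner_complex_def)

lemma interior_halfspace_Im_ge: "interior {z. Im z \<ge> b} = {z. Im z > b}"
  using interior_halfspace_ge[of \<i> b] by (simp add: inner_complex_def)

lemma maximum_modulus_frontier_at_infinity:
  assumes "closed S" "continuous_on S f" "f holomorphic_on interior S"
    and frontier: "\<And>z. z \<in> frontier S \<Longrightarrow> norm (f z) \<le> B"
    and at_infinity: "\<forall>\<^sub>F z in inf at_infinity (principal S). norm (f z) \<le> B"
    and "z \<in> S"
  shows "norm (f z) \<le> B"
proof -
  obtain b where outside_bounded: "\<And>z. norm z \<ge> b \<Longrightarrow> z \<in> S \<Longrightarrow> norm (f z) \<le> B"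
    using at_infinity unfolding eventually_inf_principal eventually_at_infinity by blast
  define R where "R = max b (norm z)"
  show ?thesis
  proof (rule maximum_modulus_frontier[where f = f])
    show "f holomorphic_on interior (S \<inter> cball 0 R)"
      by (rule holomorphic_on_subset[OF assms(3)]) (simp add: interior_mono)
    show "continuous_on (closure (S \<inter> cball 0 R)) f"
      using assms(1,2) by (simp add: closed_Int continuous_on_subset)
    show "bounded (S \<inter> cball 0 R)" by (simp add: bounded_Int)
    show "z \<in> S \<inter> cball 0 R" using \<open>z \<in> S\<close> by (simp add: R_def)
  next
    fix x assume x_frontier: "x \<in> frontier (S \<inter> cball 0 R)"
    consider "x \<in> frontier S" | "x \<in> S" "norm x = R"
      using x_frontier \<open>closed S\<close> by (auto simp: frontier_Int_closed)
    then show "norm (f x) \<le> B"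
      using frontier outside_bounded[of x] by cases (auto simp: R_def)
  qed
qed

lemma Phragmen_Lindelof:
  fixes f v :: "complex \<Rightarrow> complex"
  assumes "closed S"
    and f_regular: "continuous_on S f" "f holomorphic_on interior S"
    and v_regular: "continuous_on S v" "v holomorphic_on interior S"
    and v_nonneg: "\<And>z. z \<in> S \<Longrightarrow> Re (v z) \<ge> 0"
    and frontier: "\<And>z. z \<in> frontier S \<Longrightarrow> norm (f z) \<le> M"
    and decay: "\<And>\<epsilon>. \<epsilon> > 0 \<Longrightarrow>
      ((\<lambda>z. f z * exp (- of_real \<epsilon> * v z)) \<longlongrightarrow> 0) (inf at_infinity (principal S))"
    and "M \<ge> 0" "z \<in> S"
  shows "norm (f z) \<le> M"
proof -
  have damped: "norm (f z) * exp (- \<epsilon> * Re (v z)) - \<epsilon> \<le> M" if "\<epsilon> > 0" for \<epsilon>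
  proof -
    define g where "g = (\<lambda>z. f z * exp (- of_real \<epsilon> * v z))"
    have norm_g: "norm (g z) = norm (f z) * exp (- \<epsilon> * Re (v z))" for z
      by (simp add: g_def norm_mult)
    have "norm (g z) \<le> M + \<epsilon>"
    proof (rule maximum_modulus_frontier_at_infinity[OF \<open>closed S\<close>, where f = g])
      show "continuous_on S g" "g holomorphic_on interior S"
        unfolding g_def by (intro continuous_intros holomorphic_intros f_regular v_regular)+
      show "norm (g x) \<le> M + \<epsilon>" if "x \<in> frontier S" for x
      proof -
        have "x \<in> S" using that \<open>closed S\<close> frontier_subset_closed by blast
        then have "norm (g x) \<le> norm (f x)"
          unfolding norm_g using v_nonneg \<open>\<epsilon> > 0\<close> by (intro mult_left_le) auto
        then show ?thesis using frontier[OF that] \<open>\<epsilon> > 0\<close> by simp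
      qed
      have "(g \<longlongrightarrow> 0) (inf at_infinity (principal S))"
        using decay[OF \<open>\<epsilon> > 0\<close>] by (simp add: g_def)
      then show "\<forall>\<^sub>F x in inf at_infinity (principal S). norm (g x) \<le> M + \<epsilon>"
        using \<open>M \<ge> 0\<close> \<open>\<epsilon> > 0\<close>
        by (intro order_tendstoD(2)[OF tendsto_norm_zero, THEN eventually_mono]) auto
    qed fact
    then show ?thesis by (simp add: norm_g)
  qed
  have "((\<lambda>\<epsilon>. norm (f z) * exp (- \<epsilon> * Re (v z)) - \<epsilon>)
      \<longlongrightarrow> norm (f z) * exp (- 0 * Re (v z)) - 0) (at_right 0)"
    by (intro tendsto_intros)
  then have "norm (f z) * exp (- 0 * Re (v z)) - 0 \<le> M"
    by (rule tendsto_upperbound[OF _ eventually_mono[OF eventually_at_right_less damped]]) auto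
  then show ?thesis by simp
qed

lemma tendsto_norm_add_powr_neg:
  fixes c :: "'a :: real_normed_vector"
  assumes "a < 0"
  shows "((\<lambda>z. norm (z + c) powr a) \<longlongrightarrow> 0) at_infinity"
proof (rule tendsto_neg_powr[OF assms])
  show "filterlim (\<lambda>z. norm (z + c)) at_top at_infinity"
    using tendsto_add_filterlim_at_infinity'[OF filterlim_ident tendsto_const]
    by (rule filterlim_at_infinity_imp_norm_at_top)
qed

lemma Phragmen_Lindelof_upper_half_plane:
  assumes f_regular: "continuous_on {z. Im z \<ge> 0} f" "f holomorphic_on {z. Im z > 0}"
    and bounded: "\<And>z. Im z \<ge> 0 \<Longrightarrow> norm (f z) \<le> B"
    and real: "\<And>x. norm (f (of_real x)) \<le> M"
    and "Im z \<ge> 0"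
  shows "norm (f z) \<le> M"
proof (rule Phragmen_Lindelof[where S = "{z. Im z \<ge> 0}" and f = f and v = "\<lambda>z. Ln (z + \<i>)"])
  let ?H = "{z. Im z \<ge> 0}"
  have "z + \<i> \<notin> \<real>\<^sub>\<le>\<^sub>0" if "Im z \<ge> 0" for z
    using that by (simp add: complex_nonpos_Reals_iff)
  then show "continuous_on ?H (\<lambda>z. Ln (z + \<i>))" "(\<lambda>z. Ln (z + \<i>)) holomorphic_on interior ?H"
    by (auto simp: interior_halfspace_Im_ge
        intro!: continuous_on_Ln' continuous_on_add holomorphic_intros)
  have norm_ge_1: "norm (z + \<i>) \<ge> 1" if "z \<in> ?H" for z
    using that abs_Im_le_cmod[of "z + \<i>"] by simp
  then have Re_Ln: "Re (Ln (z + \<i>)) = ln (norm (z + \<i>))" if "z \<in> ?H" for z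
    using that by (intro Re_Ln) force
  show "Re (Ln (z + \<i>)) \<ge> 0" if "z \<in> ?H" for z
    using norm_ge_1[OF that] Re_Ln[OF that] by simp
  show "((\<lambda>z. f z * exp (- of_real \<epsilon> * Ln (z + \<i>))) \<longlongrightarrow> 0) (inf at_infinity (principal ?H))"
    if "\<epsilon> > 0" for \<epsilon>
  proof (rule Lim_null_comparison)
    have "norm (exp (- of_real \<epsilon> * Ln (z + \<i>))) = norm (z + \<i>) powr (- \<epsilon>)" if "z \<in> ?H" for z
      using Re_Ln[OF that] norm_ge_1[OF that] by (auto simp: powr_def)
    then show "\<forall>\<^sub>F z in inf at_infinity (principal ?H).
        norm (f z * exp (- of_real \<epsilon> * Ln (z + \<i>))) \<le> B * norm (z + \<i>) powr (- \<epsilon>)"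
      unfolding eventually_inf_principal norm_mult
      by (intro always_eventually) (auto intro!: mult_right_mono bounded)
    have "((\<lambda>z. B * norm (z + \<i>) powr (- \<epsilon>)) \<longlongrightarrow> 0) at_infinity"
      using tendsto_norm_add_powr_neg[of "- \<epsilon>" \<i>] \<open>\<epsilon> > 0\<close> by (auto intro: tendsto_mult_right_zero)
    then show "((\<lambda>z. B * norm (z + \<i>) powr (- \<epsilon>)) \<longlongrightarrow> 0) (inf at_infinity (principal ?H))"
      by (rule tendsto_mono[OF inf_le1])
  qed
  show "norm (f x) \<le> M" if "x \<in> frontier ?H" for x
  proof -
    have "x = of_real (Re x)"
      using that closed_halfspace_Im_ge[of 0]
      by (simp add: frontier_def interior_halfspace_Im_ge complex_eq_iff)
    then show ?thesis using real by metis
  qed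
  show "M \<ge> 0" using order_trans[OF norm_ge_zero real] .
qed (use assms closed_halfspace_Im_ge in \<open>auto simp: interior_halfspace_Im_ge\<close>)

definition quadrant :: "complex set" where
  "quadrant = {z. Re z \<ge> 0 \<and> Im z \<ge> 0}"

lemma quadrant_eq_Int_halfspaces: "quadrant = {z. Re z \<ge> 0} \<inter> {z. Im z \<ge> 0}"
  by (auto simp: quadrant_def)

lemma closed_quadrant: "closed quadrant"
  unfolding quadrant_eq_Int_halfspaces
  by (intro closed_Int closed_halfspace_Re_ge closed_halfspace_Im_ge)

lemma frontier_quadrant_cases:
  assumes "z \<in> frontier quadrant"
  obtains x where "x \<ge> 0" "z = of_real x" | y where "y \<ge> 0" "z = \<i> * of_real y"
proof -
  have "z \<in> quadrant" "z \<notin> interior quadrant"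
    using assms closed_quadrant by (simp_all add: frontier_def)
  then have "Re z \<ge> 0" "Im z \<ge> 0" "Re z = 0 \<or> Im z = 0"
    by (auto simp: quadrant_eq_Int_halfspaces interior_halfspace_Re_ge interior_halfspace_Im_ge)
  moreover from this have "z = of_real (Re z) \<or> z = \<i> * of_real (Im z)"
    by (auto simp: complex_eq_iff)
  ultimately show ?thesis using that by metis
qed

text \<open>A branch of $(e^{-i\pi/4}(z+1))^\gamma$: on the quadrant its argument has modulus at most
  $\gamma\pi/4$, which is less than $\pi/2$ when $\gamma < 2$.\<close>

definition quadrant_multiplier :: "real \<Rightarrow> complex \<Rightarrow> complex" where
  "quadrant_multiplier \<gamma> z = exp (of_real \<gamma> * (Ln (z + 1) - \<i> * of_real (pi / 4)))"

lemma holomorphic_quadrant_multiplier: "quadrant_multiplier \<gamma> holomorphic_on quadrant"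
  unfolding quadrant_multiplier_def
  by (intro holomorphic_intros) (auto simp: quadrant_def complex_nonpos_Reals_iff)

lemma Re_quadrant_multiplier_ge:
  assumes "z \<in> quadrant" "0 \<le> \<gamma>" "\<gamma> \<le> 2"
  shows "Re (quadrant_multiplier \<gamma> z) \<ge> cos (\<gamma> * pi / 4) * norm z powr \<gamma>"
proof -
  have Re_Im_nonneg: "Re z \<ge> 0" "Im z \<ge> 0" using assms(1) by (simp_all add: quadrant_def)
  then have "z + 1 \<noteq> 0" by (auto simp: complex_eq_iff)
  define \<theta> where "\<theta> = Im (Ln (z + 1)) - pi / 4"
  have "\<bar>\<theta>\<bar> \<le> pi / 4"
    using Re_Ln_pos_le[OF \<open>z + 1 \<noteq> 0\<close>] Im_Ln_pos_le[OF \<open>z + 1 \<noteq> 0\<close>] Re_Im_nonneg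
    by (auto simp: \<theta>_def abs_if split: if_splits)
  then have "\<gamma> * \<bar>\<theta>\<bar> \<le> \<gamma> * (pi / 4)"
    using assms by (intro mult_left_mono)
  moreover have "\<gamma> * (pi / 4) \<le> 2 * (pi / 4)"
    using assms by (intro mult_right_mono) auto
  moreover have "0 \<le> \<gamma> * \<bar>\<theta>\<bar>"
    using assms by simp
  ultimately have cos_mono: "cos (\<gamma> * \<bar>\<theta>\<bar>) \<ge> cos (\<gamma> * pi / 4)"
    and cos_nonneg: "cos (\<gamma> * pi / 4) \<ge> 0"
    using pi_gt_zero by (intro cos_monotone_0_pi_le cos_ge_zero; linarith)+
  have "norm z \<le> norm (z + 1)"
    using Re_Im_nonneg by (simp add: cmod_def power2_eq_square algebra_simps)
  then have "cos (\<gamma> * pi / 4) * norm z powr \<gamma> \<le> cos (\<gamma> * \<bar>\<theta>\<bar>) * norm (z + 1) powr \<gamma>"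
    using assms cos_mono cos_nonneg by (intro mult_mono powr_mono2) auto
  also have "cos (\<gamma> * \<bar>\<theta>\<bar>) = cos (\<gamma> * \<theta>)"
    by (simp add: abs_if)
  also have "cos (\<gamma> * \<theta>) * norm (z + 1) powr \<gamma> = Re (quadrant_multiplier \<gamma> z)"
    using \<open>z + 1 \<noteq> 0\<close> by (simp add: quadrant_multiplier_def Re_exp \<theta>_def powr_def)
  finally show ?thesis .
qed

lemma tendsto_exp_powr_times_exp_neg_powr:
  fixes \<rho> \<gamma> c A :: real
  assumes "\<rho> < \<gamma>" "\<gamma> > 0" "c > 0"
  shows "((\<lambda>r. exp (A * r powr \<rho>) * exp (- (c * r powr \<gamma>))) \<longlongrightarrow> 0) at_top"
proof -
  have "((\<lambda>r. c - A * r powr (\<rho> - \<gamma>)) \<longlongrightarrow> c - A * 0) at_top"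
    using \<open>\<rho> < \<gamma>\<close> by (intro tendsto_intros tendsto_neg_powr filterlim_ident) auto
  moreover have "filterlim (\<lambda>r. r powr \<gamma>) at_top at_top"
    using \<open>\<gamma> > 0\<close> by real_asymp
  ultimately have "filterlim (\<lambda>r. (c - A * r powr (\<rho> - \<gamma>)) * r powr \<gamma>) at_top at_top"
    using \<open>c > 0\<close> by (intro filterlim_tendsto_pos_mult_at_top) auto
  then have "((\<lambda>r. exp (- ((c - A * r powr (\<rho> - \<gamma>)) * r powr \<gamma>))) \<longlongrightarrow> 0) at_top"
    by (intro filterlim_compose[OF exp_at_bot]) (simp add: filterlim_uminus_at_top)
  moreover have "\<forall>\<^sub>F r in at_top. exp (- ((c - A * r powr (\<rho> - \<gamma>)) * r powr \<gamma>))
      = exp (A * r powr \<rho>) * exp (- (c * r powr \<gamma>))"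
    using eventually_gt_at_top[of 0]
    by eventually_elim (simp add: exp_add[symmetric] powr_add[symmetric] algebra_simps)
  ultimately show ?thesis
    by (rule Lim_transform_eventually)
qed

lemma tendsto_mult_exp_quadrant_multiplier:
  assumes growth: "\<And>z. z \<in> quadrant \<Longrightarrow> norm (f z) \<le> B * exp (A * norm z powr \<rho>)"
    and exponents: "\<rho> < \<gamma>" "0 < \<gamma>" "\<gamma> < 2" and "\<epsilon> > 0"
  shows "((\<lambda>z. f z * exp (- of_real \<epsilon> * quadrant_multiplier \<gamma> z)) \<longlongrightarrow> 0)
    (inf at_infinity (principal quadrant))"
proof (rule Lim_null_comparison)
  define \<kappa> where "\<kappa> = cos (\<gamma> * pi / 4)"
  have "\<kappa> > 0"
    unfolding \<kappa>_def using exponents by (intro cos_gt_zero_pi) (auto intro: less_trans[of _ 0])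
  have "B \<ge> 0"
    using order_trans[OF norm_ge_zero growth[of 0]] by (simp add: quadrant_def zero_le_mult_iff)
  let ?b = "\<lambda>r. B * exp (A * r powr \<rho>) * exp (- \<epsilon> * (\<kappa> * r powr \<gamma>))"
  have "norm (f z * exp (- of_real \<epsilon> * quadrant_multiplier \<gamma> z)) \<le> ?b (norm z)"
    if "z \<in> quadrant" for z
    unfolding norm_mult
    using growth[OF that] Re_quadrant_multiplier_ge[OF that, of \<gamma>] exponents \<open>\<epsilon> > 0\<close> \<open>B \<ge> 0\<close>
    by (intro mult_mono) (auto simp: \<kappa>_def)
  then show "\<forall>\<^sub>F z in inf at_infinity (principal quadrant).
      norm (f z * exp (- of_real \<epsilon> * quadrant_multiplier \<gamma> z)) \<le> ?b (norm z)"
    by (simp add: eventually_inf_principal)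
  have "(?b \<longlongrightarrow> 0) at_top"
    using tendsto_mult_right_zero[OF tendsto_exp_powr_times_exp_neg_powr, of \<rho> \<gamma> "\<epsilon> * \<kappa>" B A]
      exponents \<open>\<kappa> > 0\<close> \<open>\<epsilon> > 0\<close> by (simp add: mult.assoc)
  then have "((\<lambda>z. ?b (norm z)) \<longlongrightarrow> 0) at_infinity"
    using filterlim_norm_at_top by (rule filterlim_compose)
  then show "((\<lambda>z. ?b (norm z)) \<longlongrightarrow> 0) (inf at_infinity (principal quadrant))"
    by (rule tendsto_mono[OF inf_le1])
qed

theorem Phragmen_Lindelof_quadrant:
  assumes f_regular: "continuous_on quadrant f" "f holomorphic_on interior quadrant"
    and growth: "\<And>z. z \<in> quadrant \<Longrightarrow> norm (f z) \<le> B * exp (A * norm z powr \<rho>)" and "\<rho> < 2"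
    and real: "\<And>x. x \<ge> 0 \<Longrightarrow> norm (f (of_real x)) \<le> M"
    and imaginary: "\<And>y. y \<ge> 0 \<Longrightarrow> norm (f (\<i> * of_real y)) \<le> M"
    and "z \<in> quadrant"
  shows "norm (f z) \<le> M"
proof -
  obtain \<gamma> where exponents: "\<rho> < \<gamma>" "0 < \<gamma>" "\<gamma> < 2"
    using \<open>\<rho> < 2\<close> dense[of "max 0 \<rho>" 2] by auto
  let ?v = "quadrant_multiplier \<gamma>"
  show ?thesis
  proof (rule Phragmen_Lindelof[OF closed_quadrant f_regular, where v = ?v])
    show "continuous_on quadrant ?v" "?v holomorphic_on interior quadrant"
      using holomorphic_quadrant_multiplier[of \<gamma>]
      by (auto intro: holomorphic_on_imp_continuous_on holomorphic_on_subset[OF _ interior_subset])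
    have "cos (\<gamma> * pi / 4) \<ge> 0"
      using exponents by (intro cos_ge_zero) (auto intro: order_trans[of _ 0])
    then show "Re (?v z) \<ge> 0" if "z \<in> quadrant" for z
      using order_trans[OF _ Re_quadrant_multiplier_ge[OF that, of \<gamma>]] exponents by simp
    show "norm (f x) \<le> M" if "x \<in> frontier quadrant" for x
      using that real imaginary by (cases rule: frontier_quadrant_cases) auto
    show "((\<lambda>z. f z * exp (- of_real \<epsilon> * ?v z)) \<longlongrightarrow> 0) (inf at_infinity (principal quadrant))"
      if "\<epsilon> > 0" for \<epsilon>
      using growth exponents that by (rule tendsto_mult_exp_quadrant_multiplier)
    show "M \<ge> 0" using order_trans[OF norm_ge_zero real[of 0]] by simp
  qed fact
qed

subsection \<open>Entire functions on the real line\<close>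

lemma holomorphic_on_UNIV_compose:
  assumes "f holomorphic_on UNIV" "g holomorphic_on UNIV"
  shows "(\<lambda>z. f (g z)) holomorphic_on UNIV"
  using holomorphic_on_compose_gen[OF assms(2,1)] by (simp add: o_def)

lemma continuous_on_entire_real:
  assumes "f holomorphic_on UNIV"
  shows "continuous_on S (\<lambda>x. f (complex_of_real x))"
  by (intro continuous_on_compose2[OF holomorphic_on_imp_continuous_on[OF assms]]
      continuous_intros) auto

lemma borel_measurable_entire_real:
  assumes "f holomorphic_on UNIV"
  shows "(\<lambda>x. f (complex_of_real x)) \<in> borel_measurable borel"
  using borel_measurable_continuous_onI[OF continuous_on_entire_real[OF assms]] .

lemma entire_primitive:
  assumes "F holomorphic_on UNIV"
  obtains P where "\<And>z. (P has_field_derivative F z) (at z)" "P 0 = 0"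
proof -
  obtain g where g_deriv: "\<And>z. (g has_field_derivative F z) (at z)"
    using holomorphic_convex_primitive'[of UNIV F] assms by auto
  have "((\<lambda>z. g z - g 0) has_field_derivative F z) (at z)" for z
    using g_deriv by (auto intro!: derivative_eq_intros)
  then show ?thesis using that by fastforce
qed

lemma primitive_has_integral_real:
  fixes P :: "complex \<Rightarrow> complex"
  assumes "\<And>z. (P has_field_derivative F z) (at z)" "a \<le> b"
  shows "((\<lambda>x. F (of_real x)) has_integral (P (of_real b) - P (of_real a))) {a..b}"
proof (rule fundamental_theorem_of_calculus[OF assms(2)])
  fix x assume "x \<in> {a..b}"
  have "((P \<circ> of_real) has_vector_derivative 1 * F (of_real x)) (at x within {a..b})"
    by (intro field_vector_diff_chain_within)
       (auto intro!: derivative_eq_intros has_field_derivative_at_within[OF assms(1)]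
          simp: has_vector_derivative_of_real)
  then show "((\<lambda>x. P (of_real x)) has_vector_derivative F (of_real x)) (at x within {a..b})"
    by (simp add: o_def)
qed

subsection \<open>Exponential type\<close>

lemma exp_type_leI:
  assumes "\<And>z. norm (F z) \<le> C * exp (\<tau> * norm z)"
  shows "exp_type_le \<tau> F"
  unfolding exp_type_le_def
proof (intro allI impI exI)
  fix \<epsilon> :: real and z :: complex assume "\<epsilon> > 0"
  have "C \<ge> 0" using order_trans[OF norm_ge_zero assms[of 0]] by simp
  then have "C * exp (\<tau> * norm z) \<le> C * exp ((\<tau> + \<epsilon>) * norm z)"
    using \<open>\<epsilon> > 0\<close> by (intro mult_left_mono) (auto intro!: mult_right_mono)
  then show "norm (F z) \<le> C * exp ((\<tau> + \<epsilon>) * norm z)"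
    using assms[of z] by linarith
qed

lemma exp_type_leE:
  assumes "exp_type_le \<tau> F" "\<epsilon> > 0"
  obtains C where "C \<ge> 0" "\<And>z. norm (F z) \<le> C * exp ((\<tau> + \<epsilon>) * norm z)"
proof -
  obtain C where F_le: "\<And>z. norm (F z) \<le> C * exp ((\<tau> + \<epsilon>) * norm z)"
    using assms unfolding exp_type_le_def by blast
  moreover have "C \<ge> 0" using order_trans[OF norm_ge_zero F_le[of 0]] by simp
  ultimately show ?thesis using that by blast
qed

lemma exp_type_le_mult:
  assumes "exp_type_le \<sigma> F" "exp_type_le \<tau> G"
  shows "exp_type_le (\<sigma> + \<tau>) (\<lambda>z. F z * G z)"
  unfolding exp_type_le_def
proof (intro allI impI)
  fix \<epsilon> :: real assume "\<epsilon> > 0"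
  then have "\<epsilon> / 2 > 0" by simp
  obtain B where F_le: "B \<ge> 0" "\<And>z. norm (F z) \<le> B * exp ((\<sigma> + \<epsilon> / 2) * norm z)"
    using exp_type_leE[OF assms(1) \<open>\<epsilon> / 2 > 0\<close>] by blast
  obtain C where G_le: "C \<ge> 0" "\<And>z. norm (G z) \<le> C * exp ((\<tau> + \<epsilon> / 2) * norm z)"
    using exp_type_leE[OF assms(2) \<open>\<epsilon> / 2 > 0\<close>] by blast
  have "norm (F z * G z) \<le> B * C * exp ((\<sigma> + \<tau> + \<epsilon>) * norm z)" for z
  proof -
    have "norm (F z * G z)
        \<le> (B * exp ((\<sigma> + \<epsilon> / 2) * norm z)) * (C * exp ((\<tau> + \<epsilon> / 2) * norm z))"
      unfolding norm_mult using F_le G_le by (intro mult_mono) auto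
    also have "\<dots> = B * C * exp ((\<sigma> + \<tau> + \<epsilon>) * norm z)"
      by (simp add: exp_add[symmetric] algebra_simps)
    finally show ?thesis .
  qed
  then show "\<exists>C. \<forall>z. norm (F z * G z) \<le> C * exp ((\<sigma> + \<tau> + \<epsilon>) * norm z)" by blast
qed

lemma exp_type_le_const: "exp_type_le 0 (\<lambda>z. c)"
  by (rule exp_type_leI[of _ "norm c"]) simp

lemma exp_type_le_diff:
  assumes "exp_type_le \<tau> F" "exp_type_le \<tau> G"
  shows "exp_type_le \<tau> (\<lambda>z. F z - G z)"
  unfolding exp_type_le_def
proof (intro allI impI)
  fix \<epsilon> :: real assume "\<epsilon> > 0"
  obtain B where F_le: "\<And>z. norm (F z) \<le> B * exp ((\<tau> + \<epsilon>) * norm z)"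
    using exp_type_leE[OF assms(1) \<open>\<epsilon> > 0\<close>] by blast
  obtain C where G_le: "\<And>z. norm (G z) \<le> C * exp ((\<tau> + \<epsilon>) * norm z)"
    using exp_type_leE[OF assms(2) \<open>\<epsilon> > 0\<close>] by blast
  have "norm (F z - G z) \<le> (B + C) * exp ((\<tau> + \<epsilon>) * norm z)" for z
    using norm_triangle_ineq4[of "F z" "G z"] F_le[of z] G_le[of z] by (simp add: ring_distribs)
  then show "\<exists>C. \<forall>z. norm (F z - G z) \<le> C * exp ((\<tau> + \<epsilon>) * norm z)" by blast
qed

lemma exp_type_le_reflect: "exp_type_le \<tau> F \<Longrightarrow> exp_type_le \<tau> (\<lambda>z. F (- z))"
  unfolding exp_type_le_def by (metis norm_minus_cancel)

lemma entire_bounded_upper_half_plane: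
  assumes f_entire: "f holomorphic_on UNIV"
    and growth: "\<And>z. norm (f z) \<le> B * exp (A * norm z)"
    and real: "\<And>x. norm (f (of_real x)) \<le> M"
    and imaginary: "\<And>y. y \<ge> 0 \<Longrightarrow> norm (f (\<i> * of_real y)) \<le> C"
    and "Im z \<ge> 0"
  shows "norm (f z) \<le> M"
proof (rule Phragmen_Lindelof_upper_half_plane[where f = f])
  have first_quadrant: "norm (g z) \<le> max M C"
    if g_entire: "g holomorphic_on UNIV" and "\<And>z. norm (g z) \<le> B * exp (A * norm z)"
      and "\<And>x. x \<ge> 0 \<Longrightarrow> norm (g (of_real x)) \<le> max M C"
      and "\<And>y. y \<ge> 0 \<Longrightarrow> norm (g (\<i> * of_real y)) \<le> max M C"
      and "Re z \<ge> 0" "Im z \<ge> 0" for g z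
    by (rule Phragmen_Lindelof_quadrant[of g B A 1])
       (use that holomorphic_on_imp_continuous_on holomorphic_on_subset[OF g_entire]
          in \<open>auto simp: quadrant_def intro: continuous_on_subset\<close>)
  show "norm (f z) \<le> max M C" if "Im z \<ge> 0" for z
  proof (cases "Re z \<ge> 0")
    case True
    then show ?thesis
      using first_quadrant[OF f_entire growth] real imaginary that by (simp add: le_max_iff_disj)
  next
    case False
    have "norm (f (\<i> * (- \<i> * z))) \<le> max M C"
    proof (rule first_quadrant[where g = "\<lambda>z. f (\<i> * z)"])
      show "(\<lambda>z. f (\<i> * z)) holomorphic_on UNIV"
        by (intro holomorphic_on_UNIV_compose[OF f_entire] holomorphic_intros)
      show "norm (f (\<i> * z)) \<le> B * exp (A * norm z)" for z
        using growth[of "\<i> * z"] by (simp add: norm_mult)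
      show "norm (f (\<i> * (\<i> * of_real y))) \<le> max M C" for y
        using real[of "- y"] by (simp add: mult.assoc[symmetric] le_max_iff_disj)
    qed (use imaginary False that in \<open>auto simp: le_max_iff_disj\<close>)
    then show ?thesis by (simp add: mult.assoc[symmetric])
  qed
qed (use assms holomorphic_on_imp_continuous_on holomorphic_on_subset[OF f_entire]
       in \<open>auto intro: continuous_on_subset\<close>)

definition modulate :: "real \<Rightarrow> complex \<Rightarrow> (complex \<Rightarrow> complex) \<Rightarrow> complex \<Rightarrow> complex" where
  "modulate a w F z = F z * exp (\<i> * of_real a * (z - w))"

lemma holomorphic_modulate: "F holomorphic_on S \<Longrightarrow> modulate a w F holomorphic_on S"
  unfolding modulate_def[abs_def] by (intro holomorphic_intros)

lemma modulate_center [simp]: "modulate a w F w = F w"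
  by (simp add: modulate_def)

lemma norm_modulate: "norm (modulate a w F z) = norm (F z) * exp (- (a * (Im z - Im w)))"
  by (simp add: modulate_def norm_mult algebra_simps)

lemma exp_growth_bounded_on_real_axis_upper:
  assumes F_entire: "F holomorphic_on UNIV"
    and growth: "\<And>z. norm (F z) \<le> C * exp (\<sigma> * norm z)"
    and real: "\<And>x. norm (F (of_real x)) \<le> M"
    and "Im z \<ge> 0"
  shows "norm (F z) \<le> M * exp (\<sigma> * Im z)"
proof -
  let ?f = "modulate \<sigma> 0 F"
  have "C \<ge> 0" using order_trans[OF norm_ge_zero growth[of 0]] by simp
  have "norm (?f z) \<le> M"
  proof (rule entire_bounded_upper_half_plane[OF holomorphic_modulate[OF F_entire]])
    show "norm (?f z) \<le> C * exp ((\<sigma> + \<bar>\<sigma>\<bar>) * norm z)" for z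
    proof -
      have "\<bar>\<sigma> * Im z\<bar> \<le> \<bar>\<sigma>\<bar> * norm z"
        unfolding abs_mult by (intro mult_left_mono abs_Im_le_cmod) auto
      then have "norm (?f z) \<le> C * exp (\<sigma> * norm z) * exp (\<bar>\<sigma>\<bar> * norm z)"
        unfolding norm_modulate using growth \<open>C \<ge> 0\<close> by (intro mult_mono) auto
      then show ?thesis by (simp add: exp_add[symmetric] algebra_simps)
    qed
    show "norm (?f (of_real x)) \<le> M" for x
      using real[of x] by (simp add: norm_modulate)
    show "norm (?f (\<i> * of_real y)) \<le> C" if "y \<ge> 0" for y
      using growth[of "\<i> * of_real y"] that
      by (simp add: norm_modulate norm_mult exp_minus field_simps)
  qed fact
  then show ?thesis by (simp add: norm_modulate exp_minus field_simps)
qed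

lemma exp_type_bounded_on_real_axis_upper:
  assumes F_entire: "F holomorphic_on UNIV" and type: "exp_type_le \<tau> F"
    and real: "\<And>x. norm (F (of_real x)) \<le> M"
    and "Im z \<ge> 0"
  shows "norm (F z) \<le> M * exp (\<tau> * Im z)"
proof -
  have larger_type: "norm (F z) \<le> M * exp ((\<tau> + \<epsilon>) * Im z)" if "\<epsilon> > 0" for \<epsilon>
    using exp_type_leE[OF type that]
      exp_growth_bounded_on_real_axis_upper[OF F_entire _ real \<open>Im z \<ge> 0\<close>]
    by metis
  have "((\<lambda>\<epsilon>. M * exp ((\<tau> + \<epsilon>) * Im z)) \<longlongrightarrow> M * exp ((\<tau> + 0) * Im z)) (at_right 0)"
    by (intro tendsto_intros)
  then have "norm (F z) \<le> M * exp ((\<tau> + 0) * Im z)"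
    by (rule tendsto_lowerbound[OF _ eventually_mono[OF eventually_at_right_less larger_type]]) auto
  then show ?thesis by simp
qed

theorem exp_type_bounded_on_real_axis:
  assumes F_entire: "F holomorphic_on UNIV" and type: "exp_type_le \<tau> F"
    and real: "\<And>x. norm (F (of_real x)) \<le> M"
  shows "norm (F z) \<le> M * exp (\<tau> * \<bar>Im z\<bar>)"
proof (cases "Im z \<ge> 0")
  case True
  then show ?thesis using exp_type_bounded_on_real_axis_upper[OF assms] by simp
next
  case False
  have "norm (F (- (- z))) \<le> M * exp (\<tau> * Im (- z))"
  proof (rule exp_type_bounded_on_real_axis_upper[where F = "\<lambda>z. F (- z)"])
    show "(\<lambda>z. F (- z)) holomorphic_on UNIV"
      by (intro holomorphic_on_UNIV_compose[OF F_entire] holomorphic_intros)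
    show "norm (F (- of_real x)) \<le> M" for x using real[of "- x"] by simp
  qed (use False exp_type_le_reflect[OF type] in auto)
  then show ?thesis using False by simp
qed

lemma exp_type_le_primitive:
  assumes P_primitive: "\<And>z. (P has_field_derivative F z) (at z)" "P 0 = 0"
    and type: "exp_type_le \<tau> F" and "\<tau> \<ge> 0"
  shows "exp_type_le \<tau> P"
  unfolding exp_type_le_def
proof (intro allI impI)
  fix \<epsilon> :: real assume "\<epsilon> > 0"
  define \<delta> where "\<delta> = \<epsilon> / 2"
  have "\<delta> > 0" using \<open>\<epsilon> > 0\<close> by (simp add: \<delta>_def)
  obtain C where F_le: "C \<ge> 0" "\<And>z. norm (F z) \<le> C * exp ((\<tau> + \<delta>) * norm z)"
    using exp_type_leE[OF type \<open>\<delta> > 0\<close>] by blast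
  have "norm (P z) \<le> (C / \<delta>) * exp ((\<tau> + \<epsilon>) * norm z)" for z
  proof -
    have "norm (P z - P 0) \<le> C * exp ((\<tau> + \<delta>) * norm z) * norm (z - 0)"
    proof (rule field_differentiable_bound[of "cball 0 (norm z)"])
      fix y :: complex assume "y \<in> cball 0 (norm z)"
      then have "C * exp ((\<tau> + \<delta>) * norm y) \<le> C * exp ((\<tau> + \<delta>) * norm z)"
        using F_le \<open>\<tau> \<ge> 0\<close> \<open>\<delta> > 0\<close> by (intro mult_left_mono) (auto intro!: mult_left_mono)
      then show "norm (F y) \<le> C * exp ((\<tau> + \<delta>) * norm z)" using F_le(2)[of y] by simp
    qed (auto intro: has_field_derivative_at_within[OF P_primitive(1)])
    also have "\<dots> = (C / \<delta>) * exp ((\<tau> + \<delta>) * norm z) * (\<delta> * norm z)"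
      using \<open>\<delta> > 0\<close> by simp
    also have "\<dots> \<le> (C / \<delta>) * exp ((\<tau> + \<delta>) * norm z) * exp (\<delta> * norm z)"
    proof (rule mult_left_mono)
      show "\<delta> * norm z \<le> exp (\<delta> * norm z)"
        using exp_ge_add_one_self[of "\<delta> * norm z"] by linarith
    qed (use F_le \<open>\<delta> > 0\<close> in auto)
    also have "\<dots> = (C / \<delta>) * exp ((\<tau> + \<epsilon>) * norm z)"
      by (simp add: exp_add[symmetric] \<delta>_def algebra_simps)
    finally show ?thesis by (simp add: P_primitive(2))
  qed
  then show "\<exists>C. \<forall>z. norm (P z) \<le> C * exp ((\<tau> + \<epsilon>) * norm z)" by blast
qed

lemma norm_primitive_le_integral_norm:
  fixes P :: "complex \<Rightarrow> complex"
  assumes P_primitive: "\<And>z. (P has_field_derivative F z) (at z)" "P 0 = 0"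
    and F_integrable: "integrable lborel (\<lambda>x. F (complex_of_real x))"
  shows "norm (P (of_real x)) \<le> integral UNIV (\<lambda>x. norm (F (complex_of_real x)))"
proof -
  let ?N = "integral UNIV (\<lambda>x. norm (F (complex_of_real x)))"
  have norm_int: "(\<lambda>x. norm (F (complex_of_real x))) integrable_on UNIV"
    by (rule integrable_on_lborel[OF integrable_norm[OF F_integrable]])
  have increment: "norm (P (of_real b) - P (of_real a)) \<le> ?N" if "a \<le> b" for a b
  proof -
    have has_int: "((\<lambda>x. F (of_real x)) has_integral (P (of_real b) - P (of_real a))) {a..b}"
      by (rule primitive_has_integral_real[OF P_primitive(1) that])
    have norm_int_ab: "(\<lambda>x. norm (F (complex_of_real x))) integrable_on {a..b}"
      using integrable_on_subinterval[OF norm_int] by simp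
    have "norm (integral {a..b} (\<lambda>x. F (complex_of_real x)))
        \<le> integral {a..b} (\<lambda>x. norm (F (complex_of_real x)))"
      using has_int norm_int_ab by (intro integral_norm_bound_integral) auto
    also have "\<dots> \<le> ?N"
      by (intro integral_subset_le norm_int_ab norm_int) auto
    finally show ?thesis using has_int by (simp add: integral_unique)
  qed
  show ?thesis
    using increment[of 0 x] increment[of x 0] by (cases "x \<ge> 0") (auto simp: P_primitive(2))
qed

lemma norm_deriv_le_exp_Im:
  assumes P_entire: "P holomorphic_on UNIV"
    and bound: "\<And>z. norm (P z) \<le> M * exp (\<tau> * \<bar>Im z\<bar>)" and "\<tau> \<ge> 0"
  shows "norm (deriv P z) \<le> M * exp \<tau> * exp (\<tau> * \<bar>Im z\<bar>)"
proof -
  have "M \<ge> 0" using order_trans[OF norm_ge_zero bound[of 0]] by simp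
  have "norm ((deriv ^^ 1) P z) \<le> fact 1 * (M * exp \<tau> * exp (\<tau> * \<bar>Im z\<bar>)) / 1 ^ 1"
  proof (rule Cauchy_inequality[where f = P])
    show "P holomorphic_on ball z 1" "continuous_on (cball z 1) P"
      using P_entire
      by (auto intro: holomorphic_on_subset holomorphic_on_imp_continuous_on)
    fix x assume "norm (z - x) = 1"
    then have "\<bar>Im (z - x)\<bar> \<le> 1" by (metis abs_Im_le_cmod)
    then have "\<bar>Im x\<bar> \<le> 1 + \<bar>Im z\<bar>" by simp
    then have "\<tau> * \<bar>Im x\<bar> \<le> \<tau> * (1 + \<bar>Im z\<bar>)" using \<open>\<tau> \<ge> 0\<close> by (rule mult_left_mono)
    then have "M * exp (\<tau> * \<bar>Im x\<bar>) \<le> M * (exp \<tau> * exp (\<tau> * \<bar>Im z\<bar>))"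
      using \<open>M \<ge> 0\<close> by (intro mult_left_mono) (auto simp: exp_add[symmetric] algebra_simps)
    then show "norm (P x) \<le> M * exp \<tau> * exp (\<tau> * \<bar>Im z\<bar>)"
      using bound[of x] by simp
  qed auto
  then show ?thesis by simp
qed

theorem exp_type_integrable_on_real_axis:
  assumes F_entire: "F holomorphic_on UNIV" and type: "exp_type_le \<tau> F" and "\<tau> \<ge> 0"
    and F_integrable: "integrable lborel (\<lambda>x. F (complex_of_real x))"
  obtains M where "\<And>z. norm (F z) \<le> M * exp (\<tau> * \<bar>Im z\<bar>)"
proof -
  obtain P where P_primitive: "\<And>z. (P has_field_derivative F z) (at z)" "P 0 = 0"
    using entire_primitive[OF F_entire] by metis
  have "P holomorphic_on UNIV" using P_primitive(1) by (auto simp: holomorphic_on_open)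
  then have "norm (deriv P z)
      \<le> integral UNIV (\<lambda>x. norm (F (complex_of_real x))) * exp \<tau> * exp (\<tau> * \<bar>Im z\<bar>)" for z
    using exp_type_le_primitive[OF P_primitive type]
      norm_primitive_le_integral_norm[OF P_primitive F_integrable] \<open>\<tau> \<ge> 0\<close>
    by (intro norm_deriv_le_exp_Im exp_type_bounded_on_real_axis)
  then show ?thesis using that unfolding DERIV_imp_deriv[OF P_primitive(1)] by blast
qed

subsection \<open>Difference quotients integrated over the real line\<close>

definition difference_quotient :: "(complex \<Rightarrow> complex) \<Rightarrow> complex \<Rightarrow> complex \<Rightarrow> complex" where
  "difference_quotient f a z = (if z = a then deriv f a else (f z - f a) / (z - a))"

lemma holomorphic_difference_quotient:
  assumes "f holomorphic_on UNIV"
  shows "difference_quotient f a holomorphic_on UNIV"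
  unfolding difference_quotient_def[abs_def] using pole_lemma[of f UNIV a] assms by simp

lemma difference_quotient_reflect:
  assumes "f holomorphic_on UNIV"
  shows "difference_quotient (\<lambda>z. f (- z)) (- a) (- z) = - difference_quotient f a z"
proof -
  have "(f has_field_derivative deriv f a) (at a)"
    using holomorphic_derivI[OF assms] by simp
  then have "((\<lambda>z. f (- z)) has_field_derivative deriv f a * - 1) (at (- a))"
    by (intro DERIV_chain2[where f = f]) (auto intro!: derivative_eq_intros)
  then show ?thesis
    by (auto simp: difference_quotient_def DERIV_imp_deriv minus_divide_right)
qed

text \<open>The integrand of $\int (H(z) - H(w)) / (z - w)\,dz$ along the arc $z = Re^{it}$.\<close>

definition arc_integrand :: "(complex \<Rightarrow> complex) \<Rightarrow> complex \<Rightarrow> real \<Rightarrow> real \<Rightarrow> complex" where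
  "arc_integrand H w R t = \<i> * (difference_quotient H w (of_real R * cis t) * (of_real R * cis t))"

lemma integral_difference_quotient_eq_arc:
  assumes "H holomorphic_on UNIV" "R \<ge> 0"
  shows "integral {-R..R} (\<lambda>x. difference_quotient H w (of_real x))
       = - integral {0..pi} (arc_integrand H w R)"
proof -
  let ?A = "difference_quotient H w"
  obtain Q where Q_primitive: "\<And>z. (Q has_field_derivative ?A z) (at z)"
    using entire_primitive[OF holomorphic_difference_quotient[OF assms(1)]] by metis
  have "(?A has_contour_integral (Q (pathfinish (part_circlepath 0 R 0 pi))
      - Q (pathstart (part_circlepath 0 R 0 pi)))) (part_circlepath 0 R 0 pi)"
    by (rule contour_integral_primitive[of UNIV]) (use Q_primitive in auto)
  then have "(arc_integrand H w R has_integral (Q (- of_real R) - Q (of_real R))) {0..pi}"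
    by (simp add: exp_Euler has_contour_integral_part_circlepath_iff arc_integrand_def[abs_def]
        mult_ac)
  moreover have "((\<lambda>x. ?A (of_real x)) has_integral (Q (of_real R) - Q (- of_real R))) {-R..R}"
    using primitive_has_integral_real[OF Q_primitive, of "-R" R] assms(2) by simp
  ultimately show ?thesis by (simp add: integral_unique)
qed

lemma continuous_on_arc_integrand:
  assumes "H holomorphic_on UNIV"
  shows "continuous_on S (arc_integrand H w R)"
proof -
  have "continuous_on UNIV (difference_quotient H w)"
    by (intro holomorphic_on_imp_continuous_on holomorphic_difference_quotient assms)
  moreover have "continuous_on S (\<lambda>t. of_real R * cis t)"
    unfolding cis_conv_exp by (intro continuous_intros)
  ultimately have "continuous_on S (\<lambda>t. difference_quotient H w (of_real R * cis t))"
    by (rule continuous_on_compose2) simp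
  then show ?thesis
    unfolding arc_integrand_def[abs_def] using \<open>continuous_on S (\<lambda>t. of_real R * cis t)\<close>
    by (rule continuous_on_mult_left[OF continuous_on_mult])
qed

lemma norm_arc_integrand_le:
  assumes "R > 2 * norm w"
  shows "norm (arc_integrand H w R t) \<le> 2 * (norm (H (of_real R * cis t)) + norm (H w))"
proof -
  define z where "z = of_real R * cis t"
  have "R > 0" using assms norm_ge_zero[of w] by linarith
  then have norm_z_gt: "norm z > 2 * norm w" using assms by (simp add: z_def norm_mult)
  then have "norm z \<le> 2 * norm (z - w)"
    using norm_triangle_ineq2[of z w] by linarith
  moreover have "norm (z - w) > 0" using norm_z_gt by auto
  ultimately have "norm z / norm (z - w) \<le> 2" by (simp add: field_simps)
  then have "norm (H z - H w) * (norm z / norm (z - w)) \<le> (norm (H z) + norm (H w)) * 2"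
    by (intro mult_mono norm_triangle_ineq4) auto
  moreover have "z \<noteq> w" using norm_z_gt by auto
  ultimately show ?thesis
    by (simp add: arc_integrand_def difference_quotient_def norm_mult norm_divide flip: z_def)
qed

lemma tendsto_arc_integrand:
  assumes "((\<lambda>R. H (of_real R * cis t)) \<longlongrightarrow> 0) at_top"
  shows "((\<lambda>R. arc_integrand H w R t) \<longlongrightarrow> - (\<i> * H w)) at_top"
proof -
  define z where "z = (\<lambda>R. of_real R * cis t)"
  have z_at_infinity: "filterlim z at_infinity at_top"
    unfolding z_def
    by (rule filterlim_norm_at_top_imp_at_infinity) (simp add: norm_mult filterlim_abs_real)
  then have "filterlim (\<lambda>R. - w + z R) at_infinity at_top"
    by (rule tendsto_add_filterlim_at_infinity[OF tendsto_const])
  then have "((\<lambda>R. w / (- w + z R)) \<longlongrightarrow> 0) at_top"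
    by (rule tendsto_divide_0[OF tendsto_const])
  moreover have "((\<lambda>R. H (z R)) \<longlongrightarrow> 0) at_top" using assms by (simp add: z_def)
  ultimately have "((\<lambda>R. \<i> * ((H (z R) - H w) * (1 + w / (- w + z R)))) \<longlongrightarrow> \<i> * ((0 - H w) * (1 + 0)))
      at_top"
    by (intro tendsto_intros)
  moreover have "\<i> * ((H (z R) - H w) * (1 + w / (- w + z R))) = arc_integrand H w R t"
    if "z R \<noteq> w" for R
  proof -
    have "arc_integrand H w R t = \<i> * (difference_quotient H w (z R) * z R)"
      by (simp add: arc_integrand_def z_def)
    then show ?thesis using that by (simp add: difference_quotient_def field_simps)
  qed
  then have "\<forall>\<^sub>F R in at_top. \<i> * ((H (z R) - H w) * (1 + w / (- w + z R))) = arc_integrand H w R t"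
    using filterlim_at_infinity_imp_eventually_ne[OF z_at_infinity]
    by (rule eventually_mono[rotated])
  ultimately show ?thesis using Lim_transform_eventually by fastforce
qed

lemma arc_integral_tendsto:
  assumes H_entire: "H holomorphic_on UNIV"
    and bounded: "\<And>z. Im z \<ge> 0 \<Longrightarrow> norm (H z) \<le> C"
    and rays: "\<And>t. 0 < t \<Longrightarrow> t < pi \<Longrightarrow> ((\<lambda>R. H (of_real R * cis t)) \<longlongrightarrow> 0) at_top"
  shows "((\<lambda>R. integral {0..pi} (arc_integrand H w R)) \<longlongrightarrow> - (\<i> * pi * H w)) at_top"
proof -
  let ?M = "lebesgue_on {0..pi}"
  have "((\<lambda>R. integral\<^sup>L ?M (arc_integrand H w R)) \<longlongrightarrow> integral\<^sup>L ?M (\<lambda>t. - (\<i> * H w))) at_top"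
  proof (rule integral_dominated_convergence_at_top)
    show "arc_integrand H w R \<in> borel_measurable ?M" for R
      by (intro continuous_imp_measurable_on_sets_lebesgue continuous_on_arc_integrand H_entire)
        simp
    have "norm (arc_integrand H w R t) \<le> 2 * (C + norm (H w))"
      if "R > 2 * norm w" "t \<in> {0..pi}" for R t
    proof -
      have "R > 0" using that norm_ge_zero[of w] by linarith
      then have "norm (H (of_real R * cis t)) \<le> C"
        using that by (intro bounded) (simp add: sin_ge_zero)
      then have "2 * (norm (H (of_real R * cis t)) + norm (H w)) \<le> 2 * (C + norm (H w))"
        by simp
      then show ?thesis
        using norm_arc_integrand_le[OF that(1)] order_trans by blast
    qed
    then show "\<forall>\<^sub>F R in at_top. AE t in ?M. norm (arc_integrand H w R t) \<le> 2 * (C + norm (H w))"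
      by (auto intro!: eventually_mono[OF eventually_gt_at_top[of "2 * norm w"]] AE_I2)
    have "AE t in lebesgue. t \<notin> {0, pi}"
      by (intro AE_not_in) (simp add: negligible_iff_null_sets[symmetric])
    then have "AE t in lebesgue. t \<in> {0..pi} \<longrightarrow>
        ((\<lambda>R. arc_integrand H w R t) \<longlongrightarrow> - (\<i> * H w)) at_top"
      by (rule eventually_mono) (auto intro!: tendsto_arc_integrand rays)
    then show "AE t in ?M. ((\<lambda>R. arc_integrand H w R t) \<longlongrightarrow> - (\<i> * H w)) at_top"
      by (simp add: AE_restrict_space_iff)
  qed auto
  moreover have "integral\<^sup>L ?M (arc_integrand H w R) = integral {0..pi} (arc_integrand H w R)" for R
    by (intro lebesgue_integral_eq_integral continuous_imp_integrable_real
        continuous_on_arc_integrand H_entire) simp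
  moreover have "integral\<^sup>L ?M (\<lambda>t. - (\<i> * H w)) = - (\<i> * pi * H w)"
    by (subst lebesgue_integral_eq_integral) (auto simp: scaleR_conv_of_real)
  ultimately show ?thesis by simp
qed

lemma difference_quotient_integral_upper:
  assumes H_entire: "H holomorphic_on UNIV"
    and decay: "\<And>z. Im z \<ge> 0 \<Longrightarrow> norm (H z) \<le> C * exp (- (\<delta> * Im z))" and "\<delta> > 0"
  shows "((\<lambda>R. integral {-R..R} (\<lambda>x. difference_quotient H w (of_real x)))
           \<longlongrightarrow> \<i> * pi * H w) at_top"
proof -
  have "C \<ge> 0" using order_trans[OF norm_ge_zero decay[of 0]] by simp
  have "((\<lambda>R. integral {0..pi} (arc_integrand H w R)) \<longlongrightarrow> - (\<i> * pi * H w)) at_top"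
  proof (rule arc_integral_tendsto[OF H_entire])
    show "norm (H z) \<le> C" if "Im z \<ge> 0" for z
      using order_trans[OF decay[OF that] mult_left_le] that \<open>C \<ge> 0\<close> \<open>\<delta> > 0\<close> by simp
    show "((\<lambda>R. H (of_real R * cis t)) \<longlongrightarrow> 0) at_top" if "0 < t" "t < pi" for t
    proof (rule Lim_null_comparison)
      have "sin t > 0" using that by (rule sin_gt_zero)
      show "\<forall>\<^sub>F R in at_top. norm (H (of_real R * cis t)) \<le> C * exp (- (\<delta> * (R * sin t)))"
        using eventually_ge_at_top[of 0]
        by eventually_elim (use decay[of "of_real _ * cis t"] \<open>sin t > 0\<close> in simp)
      show "((\<lambda>R. C * exp (- (\<delta> * (R * sin t)))) \<longlongrightarrow> 0) at_top"
        using \<open>\<delta> > 0\<close> \<open>sin t > 0\<close> by real_asymp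
    qed
  qed
  then have "((\<lambda>R. - integral {0..pi} (arc_integrand H w R)) \<longlongrightarrow> \<i> * pi * H w) at_top"
    using tendsto_minus by fastforce
  moreover have "\<forall>\<^sub>F R in at_top. - integral {0..pi} (arc_integrand H w R)
      = integral {-R..R} (\<lambda>x. difference_quotient H w (of_real x))"
    using eventually_ge_at_top[of 0]
    by eventually_elim (simp add: integral_difference_quotient_eq_arc[OF H_entire])
  ultimately show ?thesis by (rule Lim_transform_eventually)
qed

lemma difference_quotient_integral_lower:
  assumes H_entire: "H holomorphic_on UNIV"
    and decay: "\<And>z. Im z \<le> 0 \<Longrightarrow> norm (H z) \<le> C * exp (\<delta> * Im z)" and "\<delta> > 0"
  shows "((\<lambda>R. integral {-R..R} (\<lambda>x. difference_quotient H w (of_real x)))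
           \<longlongrightarrow> - (\<i> * pi * H w)) at_top"
proof -
  let ?A = "\<lambda>x. difference_quotient H w (complex_of_real x)"
  let ?B = "\<lambda>x. difference_quotient (\<lambda>z. H (- z)) (- w) (complex_of_real x)"
  have "((\<lambda>R. integral {-R..R} ?B) \<longlongrightarrow> \<i> * pi * H (- (- w))) at_top"
  proof (rule difference_quotient_integral_upper[where C = C and \<delta> = \<delta>])
    show "(\<lambda>z. H (- z)) holomorphic_on UNIV"
      by (intro holomorphic_on_UNIV_compose[OF H_entire] holomorphic_intros)
    show "norm (H (- z)) \<le> C * exp (- (\<delta> * Im z))" if "Im z \<ge> 0" for z
      using decay[of "- z"] that by simp
  qed fact
  moreover have "integral {-R..R} ?B = - integral {-R..R} ?A" for R
  proof -
    have "integral {-R..R} ?B = integral {-R..R} (\<lambda>x. ?B (- x))"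
      using Henstock_Kurzweil_Integration.integral_reflect_real[of R "-R" ?B] by simp
    then show ?thesis by (simp add: difference_quotient_reflect[OF H_entire])
  qed
  ultimately show ?thesis using tendsto_minus by fastforce
qed

subsection \<open>The cardinal sine\<close>

lemma norm_sin_le:
  fixes v :: complex
  shows "norm (sin v) \<le> norm v * exp \<bar>Im v\<bar>"
proof -
  have "norm (sin v - sin 0) \<le> exp \<bar>Im v\<bar> * norm (v - 0)"
  proof (rule field_differentiable_bound[of "closed_segment 0 v"])
    fix z assume "z \<in> closed_segment 0 v"
    then obtain u where "0 \<le> u" "u \<le> 1" "z = u *\<^sub>R v" by (auto simp: in_segment)
    then show "norm (cos z) \<le> exp \<bar>Im v\<bar>" using cmod_cos_le_exp by metis
  qed (auto intro!: derivative_eq_intros)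
  then show ?thesis by (simp add: mult.commute)
qed

lemma norm_sincD_le:
  assumes "D \<ge> 0"
  shows "norm (sincD D z) \<le> D * exp (pi * D * \<bar>Im z\<bar>)"
proof (cases "z = 0")
  case False
  have "norm (sin (complex_of_real (pi * D) * z)) \<le> pi * D * norm z * exp (pi * D * \<bar>Im z\<bar>)"
    using norm_sin_le[of "complex_of_real (pi * D) * z"] assms by (simp add: norm_mult abs_mult)
  then show ?thesis using False by (simp add: sincD_def norm_divide norm_mult field_simps)
qed (use assms in \<open>simp add: sincD_def\<close>)

lemma norm_mult_sincD_le:
  assumes "D \<ge> 0"
  shows "norm z * norm (sincD D z) \<le> exp (pi * D * \<bar>Im z\<bar>)"
proof (cases "z = 0")
  case False
  have "norm (sin (complex_of_real (pi * D) * z)) \<le> exp (pi * D * \<bar>Im z\<bar>)"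
    using cmod_sin_le_exp[of 1 "complex_of_real (pi * D) * z"] assms by (simp add: abs_mult)
  also have "\<dots> \<le> pi * exp (pi * D * \<bar>Im z\<bar>)"
    using pi_ge_two by simp
  finally show ?thesis using False by (simp add: sincD_def norm_divide norm_mult field_simps)
qed simp

lemma norm_sincD_decay:
  assumes "0 \<le> D" "D \<le> E"
  shows "norm (sincD D z) \<le> (E + 1) * exp (pi * E * \<bar>Im z\<bar>) / (1 + norm z)"
proof -
  have "(1 + norm z) * norm (sincD D z) \<le> (D + 1) * exp (pi * D * \<bar>Im z\<bar>)"
    using norm_sincD_le[OF assms(1), of z] norm_mult_sincD_le[OF assms(1), of z]
    by (simp add: algebra_simps)
  also have "\<dots> \<le> (E + 1) * exp (pi * E * \<bar>Im z\<bar>)"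
    using assms by (intro mult_mono) (auto intro!: mult_right_mono)
  finally show ?thesis by (simp add: field_simps add_pos_nonneg)
qed

lemma cnj_sincD: "cnj (sincD D z) = sincD D (cnj z)"
  by (simp add: sincD_def cnj_sin)

lemma sincD_minus: "sincD D (- z) = sincD D z"
  by (simp add: sincD_def)

lemma tendsto_sincD:
  assumes "(f \<longlongrightarrow> D) F"
  shows "((\<lambda>x. sincD (f x) z) \<longlongrightarrow> sincD D z) F"
proof (cases "z = 0")
  case True
  then show ?thesis using assms by (simp add: sincD_def tendsto_of_real)
next
  case False
  have "((\<lambda>x. sin (complex_of_real (pi * f x) * z)) \<longlongrightarrow> sin (complex_of_real (pi * D) * z)) F"
    by (intro isCont_tendsto_compose[OF isCont_sin] tendsto_intros assms)
  then show ?thesis using False unfolding sincD_def by (auto intro!: tendsto_intros)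
qed

lemma holomorphic_sincD: "sincD D holomorphic_on UNIV"
proof -
  define f where "f = (\<lambda>z. sin (complex_of_real (pi * D) * z) / complex_of_real pi)"
  have "(f has_field_derivative of_real D) (at 0)"
    unfolding f_def by (auto intro!: derivative_eq_intros)
  then have "difference_quotient f 0 = sincD D"
    by (auto simp: fun_eq_iff difference_quotient_def sincD_def f_def dest: DERIV_imp_deriv)
  moreover have "f holomorphic_on UNIV" unfolding f_def by (intro holomorphic_intros) auto
  ultimately show ?thesis using holomorphic_difference_quotient[of f 0] by simp
qed

lemma holomorphic_on_sincD [holomorphic_intros]:
  "f holomorphic_on UNIV \<Longrightarrow> (\<lambda>z. sincD D (f z)) holomorphic_on UNIV"
  by (rule holomorphic_on_UNIV_compose[OF holomorphic_sincD])

lemma mult_sincD_eq_difference_quotients: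
  assumes F_entire: "F holomorphic_on UNIV"
  shows "F z * sincD \<sigma> (z - w)
    = (difference_quotient (modulate (pi * \<sigma>) w F) w z
       - difference_quotient (modulate (- (pi * \<sigma>)) w F) w z) / (2 * \<i> * pi)"
proof (cases "z = w")
  case True
  have "(F has_field_derivative deriv F w) (at w)"
    using holomorphic_derivI[OF F_entire] by simp
  then have "(modulate a w F has_field_derivative deriv F w + F w * (\<i> * of_real a)) (at w)" for a
    unfolding modulate_def[abs_def] by (auto intro!: derivative_eq_intros)
  then have "deriv (modulate a w F) w = deriv F w + F w * (\<i> * of_real a)" for a
    by (rule DERIV_imp_deriv)
  then show ?thesis using True by (simp add: difference_quotient_def sincD_def field_simps)
next
  case False
  let ?u = "of_real (pi * \<sigma>) * (z - w)"
  have "modulate (pi * \<sigma>) w F z - modulate (- (pi * \<sigma>)) w F z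
      = F z * (exp (\<i> * ?u) - exp (- (\<i> * ?u)))"
    by (simp add: modulate_def algebra_simps)
  also have "\<dots> = F z * (2 * \<i> * sin ?u)"
    by (simp add: sin_exp_eq)
  finally have "difference_quotient (modulate (pi * \<sigma>) w F) w z
      - difference_quotient (modulate (- (pi * \<sigma>)) w F) w z = F z * (2 * \<i> * sin ?u) / (z - w)"
    using False by (simp add: difference_quotient_def diff_divide_distrib[symmetric])
  then show ?thesis using False by (simp add: sincD_def)
qed

lemma integral_mult_sincD_tendsto:
  assumes F_entire: "F holomorphic_on UNIV"
    and bound: "\<And>z. norm (F z) \<le> M * exp (pi * D * \<bar>Im z\<bar>)" and "D < \<sigma>"
  shows "((\<lambda>R. integral {-R..R} (\<lambda>x. F (of_real x) * sincD \<sigma> (of_real x - w))) \<longlongrightarrow> F w) at_top"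
proof -
  let ?A = "\<lambda>a x. difference_quotient (modulate a w F) w (complex_of_real x)"
  define \<delta> where "\<delta> = pi * (\<sigma> - D)"
  have "\<delta> > 0" using \<open>D < \<sigma>\<close> by (simp add: \<delta>_def)
  have norm_modulate_le: "norm (modulate a w F z) \<le> M * exp (pi * D * \<bar>Im z\<bar> - a * (Im z - Im w))"
    for a z
    using mult_right_mono[OF bound, of "exp (- (a * (Im z - Im w)))" z]
    by (simp add: norm_modulate exp_add[symmetric] mult.assoc)
  have upper: "((\<lambda>R. integral {-R..R} (?A (pi * \<sigma>))) \<longlongrightarrow> \<i> * pi * modulate (pi * \<sigma>) w F w) at_top"
  proof (rule difference_quotient_integral_upper[OF holomorphic_modulate[OF F_entire] _ \<open>\<delta> > 0\<close>])
    show "norm (modulate (pi * \<sigma>) w F z) \<le> M * exp (pi * \<sigma> * Im w) * exp (- (\<delta> * Im z))"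
      if "Im z \<ge> 0" for z
      using norm_modulate_le[of "pi * \<sigma>" z] that
      by (simp add: exp_add[symmetric] \<delta>_def algebra_simps)
  qed
  have lower: "((\<lambda>R. integral {-R..R} (?A (- (pi * \<sigma>))))
      \<longlongrightarrow> - (\<i> * pi * modulate (- (pi * \<sigma>)) w F w)) at_top"
  proof (rule difference_quotient_integral_lower[OF holomorphic_modulate[OF F_entire] _ \<open>\<delta> > 0\<close>])
    show "norm (modulate (- (pi * \<sigma>)) w F z) \<le> M * exp (- (pi * \<sigma> * Im w)) * exp (\<delta> * Im z)"
      if "Im z \<le> 0" for z
      using norm_modulate_le[of "- (pi * \<sigma>)" z] that
      by (simp add: exp_add[symmetric] \<delta>_def algebra_simps)
  qed
  have integrable: "?A a integrable_on {-R..R}" for a R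
    by (intro integrable_continuous_real continuous_on_entire_real holomorphic_difference_quotient
        holomorphic_modulate F_entire)
  have "integral {-R..R} (\<lambda>x. F (of_real x) * sincD \<sigma> (of_real x - w))
      = (integral {-R..R} (?A (pi * \<sigma>)) - integral {-R..R} (?A (- (pi * \<sigma>)))) / (2 * \<i> * pi)" for R
    by (simp only: mult_sincD_eq_difference_quotients[OF F_entire] integral_divide
        integral_diff[OF integrable integrable])
  moreover have "((\<lambda>R. (integral {-R..R} (?A (pi * \<sigma>)) - integral {-R..R} (?A (- (pi * \<sigma>))))
        / (2 * \<i> * pi))
      \<longlongrightarrow> (\<i> * pi * F w - - (\<i> * pi * F w)) / (2 * \<i> * pi)) at_top"
    using upper lower by (intro tendsto_intros) auto
  ultimately show ?thesis by simp
qed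

subsection \<open>Square integrable functions\<close>

definition square_integrable ::
    "'a measure \<Rightarrow> ('a \<Rightarrow> 'b :: {real_normed_vector, second_countable_topology}) \<Rightarrow> bool" where
  "square_integrable M f \<longleftrightarrow> f \<in> borel_measurable M \<and> integrable M (\<lambda>x. (norm (f x))\<^sup>2)"

lemma square_integrable_bound:
  fixes f :: "'a \<Rightarrow> 'b :: {real_normed_vector, second_countable_topology}"
  assumes "square_integrable M g" "f \<in> borel_measurable M"
    and "\<And>x. norm (f x) \<le> C * norm (g x)"
  shows "square_integrable M f"
  unfolding square_integrable_def
proof
  show "integrable M (\<lambda>x. (norm (f x))\<^sup>2)"
  proof (rule Bochner_Integration.integrable_bound)
    show "integrable M (\<lambda>x. C\<^sup>2 * (norm (g x))\<^sup>2)"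
      using assms(1) by (simp add: square_integrable_def)
    show "(\<lambda>x. (norm (f x))\<^sup>2) \<in> borel_measurable M"
      using assms(2) by measurable
    have "(norm (f x))\<^sup>2 \<le> C\<^sup>2 * (norm (g x))\<^sup>2" for x
      using power_mono[OF assms(3), of x 2] by (simp add: power_mult_distrib)
    then show "AE x in M. norm ((norm (f x))\<^sup>2) \<le> norm (C\<^sup>2 * (norm (g x))\<^sup>2)"
      by (intro AE_I2) simp
  qed
qed fact

lemma square_integrable_cnj:
  assumes "square_integrable M f"
  shows "square_integrable M (\<lambda>x. cnj (f x))"
proof -
  have "cnj \<in> borel_measurable borel"
    by (intro borel_measurable_continuous_onI continuous_intros)
  then show ?thesis
    using assms measurable_compose[of f M borel cnj borel] by (simp add: square_integrable_def)
qed

lemma square_integrable_diff: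
  fixes f g :: "'a \<Rightarrow> 'b :: {real_normed_vector, second_countable_topology}"
  assumes "square_integrable M f" "square_integrable M g"
  shows "square_integrable M (\<lambda>x. f x - g x)"
  unfolding square_integrable_def
proof
  have [measurable]: "f \<in> borel_measurable M" "g \<in> borel_measurable M"
    using assms by (auto simp: square_integrable_def)
  show "(\<lambda>x. f x - g x) \<in> borel_measurable M" by measurable
  show "integrable M (\<lambda>x. (norm (f x - g x))\<^sup>2)"
  proof (rule Bochner_Integration.integrable_bound)
    show "integrable M (\<lambda>x. 2 * (norm (f x))\<^sup>2 + 2 * (norm (g x))\<^sup>2)"
      using assms by (simp add: square_integrable_def)
    show "(\<lambda>x. (norm (f x - g x))\<^sup>2) \<in> borel_measurable M" by measurable
    have "(norm (a - b))\<^sup>2 \<le> 2 * (norm a)\<^sup>2 + 2 * (norm b)\<^sup>2" for a b :: 'b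
    proof -
      have "(norm (a - b))\<^sup>2 \<le> (norm a + norm b)\<^sup>2"
        by (intro power_mono norm_triangle_ineq4) auto
      also have "\<dots> \<le> 2 * (norm a)\<^sup>2 + 2 * (norm b)\<^sup>2"
        using sum_squares_bound[of "norm a" "norm b"] by (simp add: power2_sum)
      finally show ?thesis .
    qed
    then show "AE x in M. norm ((norm (f x - g x))\<^sup>2)
        \<le> norm (2 * (norm (f x))\<^sup>2 + 2 * (norm (g x))\<^sup>2)"
      by (intro AE_I2) simp
  qed
qed

lemma integrable_mult_square_integrable:
  fixes f g :: "'a \<Rightarrow> 'b :: {real_normed_algebra, second_countable_topology, banach}"
  assumes "square_integrable M f" "square_integrable M g"
  shows "integrable M (\<lambda>x. f x * g x)"
proof (rule Bochner_Integration.integrable_bound)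
  show "integrable M (\<lambda>x. (norm (f x))\<^sup>2 + (norm (g x))\<^sup>2)"
    using assms by (auto simp: square_integrable_def)
  show "(\<lambda>x. f x * g x) \<in> borel_measurable M"
    using assms by (auto simp: square_integrable_def)
  have "norm (a * b) \<le> (norm a)\<^sup>2 + (norm b)\<^sup>2" for a b :: 'b
    using norm_mult_ineq[of a b] sum_squares_bound[of "norm a" "norm b"]
      mult_nonneg_nonneg[OF norm_ge_zero[of a] norm_ge_zero[of b]] by linarith
  then show "AE x in M. norm (f x * g x) \<le> norm ((norm (f x))\<^sup>2 + (norm (g x))\<^sup>2)"
    by simp
qed

lemma square_integrable_inverse_one_plus_norm:
  "square_integrable lborel (\<lambda>x. 1 / (1 + norm (complex_of_real x - w)))"
  unfolding square_integrable_def
proof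
  have "integrable lborel (\<lambda>x::real. inverse (1 + x\<^sup>2))"
    using integrable_inverse_1_plus_square by (simp add: set_integrable_def)
  from lborel_integrable_real_affine[OF this, of 1 "- Re w"]
  have "integrable lborel (\<lambda>x. inverse (1 + (x - Re w)\<^sup>2))" by simp
  moreover have "(norm (1 / (1 + norm (complex_of_real x - w))))\<^sup>2 \<le> inverse (1 + (x - Re w)\<^sup>2)"
    for x
  proof -
    let ?n = "norm (complex_of_real x - w)"
    have "(x - Re w)\<^sup>2 \<le> ?n\<^sup>2"
      using abs_Re_le_cmod[of "complex_of_real x - w"] abs_le_square_iff by fastforce
    then have "1 + (x - Re w)\<^sup>2 \<le> 1 + ?n\<^sup>2 + 2 * 1 * ?n"
      using norm_ge_zero[of "complex_of_real x - w"] by linarith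
    also have "\<dots> = (1 + ?n)\<^sup>2" by (simp add: power2_sum)
    finally have "inverse ((1 + ?n)\<^sup>2) \<le> inverse (1 + (x - Re w)\<^sup>2)"
      by (intro le_imp_inverse_le) (auto intro: add_pos_nonneg)
    then show ?thesis by (simp add: divide_inverse power_inverse)
  qed
  ultimately show "integrable lborel (\<lambda>x. (norm (1 / (1 + norm (complex_of_real x - w))))\<^sup>2)"
    by (elim Bochner_Integration.integrable_bound) auto
qed auto

lemma square_integrable_sincD:
  assumes "D \<ge> 0"
  shows "square_integrable lborel (\<lambda>x. sincD D (complex_of_real x - w))"
proof (rule square_integrable_bound[OF square_integrable_inverse_one_plus_norm[of w]])
  show "(\<lambda>x. sincD D (complex_of_real x - w)) \<in> borel_measurable lborel"
    using borel_measurable_entire_real[of "\<lambda>z. sincD D (z - w)"] by (simp add: holomorphic_intros)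
  show "norm (sincD D (complex_of_real x - w))
      \<le> (D + 1) * exp (pi * D * \<bar>Im w\<bar>) * norm (1 / (1 + norm (complex_of_real x - w)))" for x
    using norm_sincD_decay[OF assms order_refl, of "of_real x - w"] by simp
qed

subsection \<open>The Paley--Wiener reproducing formula\<close>

lemma mem_HO_iff:
  "F \<in> HO D \<longleftrightarrow> F holomorphic_on UNIV \<and> exp_type_le (pi * D) F
     \<and> square_integrable lborel (\<lambda>x. F (complex_of_real x))"
  using borel_measurable_entire_real[of F] by (auto simp: HO_def square_integrable_def)

lemma HO_scale:
  assumes "F \<in> HO D"
  shows "(\<lambda>z. c * F z) \<in> HO D"
proof -
  have "exp_type_le (pi * D) (\<lambda>z. c * F z)"
    using exp_type_le_mult[OF exp_type_le_const, of "pi * D" F c] assms by (simp add: mem_HO_iff)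
  moreover have "square_integrable lborel (\<lambda>x. c * F (complex_of_real x))"
    by (rule square_integrable_bound[of _ "\<lambda>x. F (of_real x)" _ "norm c"])
       (use assms in \<open>auto simp: mem_HO_iff norm_mult square_integrable_def\<close>)
  ultimately show ?thesis using assms by (simp add: mem_HO_iff holomorphic_on_mult)
qed

lemma HO_diff: "F \<in> HO D \<Longrightarrow> G \<in> HO D \<Longrightarrow> (\<lambda>z. F z - G z) \<in> HO D"
  unfolding mem_HO_iff by (auto intro: holomorphic_on_diff exp_type_le_diff square_integrable_diff)

lemma sincD_mem_HO:
  assumes "D \<ge> 0"
  shows "(\<lambda>z. sincD D (z - w)) \<in> HO D"
  unfolding mem_HO_iff
proof (intro conjI)
  show "exp_type_le (pi * D) (\<lambda>z. sincD D (z - w))"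
  proof (rule exp_type_leI)
    fix z
    have "\<bar>Im (z - w)\<bar> \<le> norm z + \<bar>Im w\<bar>" using abs_Im_le_cmod[of z] by simp
    then have "pi * D * \<bar>Im (z - w)\<bar> \<le> pi * D * (norm z + \<bar>Im w\<bar>)"
      using assms by (intro mult_left_mono) auto
    then have "D * exp (pi * D * \<bar>Im (z - w)\<bar>) \<le> D * exp (pi * D * (norm z + \<bar>Im w\<bar>))"
      using assms by (intro mult_left_mono) auto
    also have "\<dots> = D * exp (pi * D * \<bar>Im w\<bar>) * exp (pi * D * norm z)"
      by (simp add: exp_add algebra_simps)
    finally show "norm (sincD D (z - w)) \<le> D * exp (pi * D * \<bar>Im w\<bar>) * exp (pi * D * norm z)"
      using norm_sincD_le[OF assms, of "z - w"] by linarith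
  qed
  show "(\<lambda>z. sincD D (z - w)) holomorphic_on UNIV" by (intro holomorphic_intros)
  show "square_integrable lborel (\<lambda>x. sincD D (complex_of_real x - w))"
    by (rule square_integrable_sincD[OF assms])
qed

lemma HO_exponential_bound:
  assumes "F \<in> HO D" "D \<ge> 0"
  obtains M where "\<And>z. norm (F z) \<le> M * exp (pi * D * \<bar>Im z\<bar>)"
proof -
  have "(\<lambda>z. F z * F z) holomorphic_on UNIV"
    using assms(1) by (simp add: mem_HO_iff holomorphic_on_mult)
  moreover have "exp_type_le (pi * D + pi * D) (\<lambda>z. F z * F z)"
    using assms(1) unfolding mem_HO_iff by (intro exp_type_le_mult) auto
  moreover have "pi * D + pi * D \<ge> 0" using assms(2) by simp
  moreover have "integrable lborel (\<lambda>x. F (complex_of_real x) * F (of_real x))"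
    using assms(1) by (simp add: mem_HO_iff integrable_mult_square_integrable)
  ultimately obtain M where square_le: "\<And>z. norm (F z * F z) \<le> M * exp ((pi * D + pi * D) * \<bar>Im z\<bar>)"
    by (rule exp_type_integrable_on_real_axis) blast
  have "norm (F z) \<le> sqrt M * exp (pi * D * \<bar>Im z\<bar>)" for z
  proof -
    have "(norm (F z))\<^sup>2 \<le> M * (exp (pi * D * \<bar>Im z\<bar>))\<^sup>2"
      using square_le[of z]
      by (simp add: norm_mult power2_eq_square exp_add[symmetric] algebra_simps)
    then show ?thesis
      using real_le_rsqrt by (fastforce simp: real_sqrt_mult)
  qed
  then show ?thesis using that by blast
qed

lemma tendsto_integral_symmetric:
  fixes f :: "real \<Rightarrow> 'b :: euclidean_space"
  assumes "integrable lborel f"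
  shows "((\<lambda>R. integral {-R..R} f) \<longlongrightarrow> (LINT x|lborel. f x)) at_top"
proof -
  have "((\<lambda>R. LINT x|lborel. indicator {-R..R} x *\<^sub>R f x) \<longlongrightarrow> (LINT x|lborel. f x)) at_top"
  proof (rule integral_dominated_convergence_at_top)
    show "integrable lborel (\<lambda>x. norm (f x))" using assms by simp
    show "AE x in lborel. ((\<lambda>R. indicator {-R..R} x *\<^sub>R f x) \<longlongrightarrow> f x) at_top"
    proof (rule AE_I2, rule tendsto_eventually)
      show "\<forall>\<^sub>F R in at_top. indicator {-R..R} x *\<^sub>R f x = f x" for x
        using eventually_ge_at_top[of "\<bar>x\<bar>"] by eventually_elim (auto simp: indicator_def)
    qed
  qed (use assms in \<open>auto simp: indicator_def\<close>)
  moreover have "(LINT x|lborel. indicator {-R..R} x *\<^sub>R f x) = integral {-R..R} f" for R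
    using set_borel_integral_eq_integral(2)[OF set_integrable_subset[of lborel UNIV f "{-R..R}"]]
      assms
    by (simp add: set_lebesgue_integral_def set_integrable_def)
  ultimately show ?thesis by simp
qed

lemma reproducing_formula_larger_type:
  assumes F_in_HO: "F \<in> HO D" and "0 \<le> D" "D < \<sigma>"
  shows "(LINT x|lborel. F (complex_of_real x) * sincD \<sigma> (of_real x - w)) = F w"
proof -
  obtain M where "\<And>z. norm (F z) \<le> M * exp (pi * D * \<bar>Im z\<bar>)"
    using HO_exponential_bound[OF F_in_HO \<open>0 \<le> D\<close>] by blast
  then have "((\<lambda>R. integral {-R..R} (\<lambda>x. F (of_real x) * sincD \<sigma> (of_real x - w))) \<longlongrightarrow> F w) at_top"
    using F_in_HO \<open>D < \<sigma>\<close> by (intro integral_mult_sincD_tendsto) (auto simp: mem_HO_iff)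
  moreover have "integrable lborel (\<lambda>x. F (complex_of_real x) * sincD \<sigma> (of_real x - w))"
    using assms
    by (intro integrable_mult_square_integrable square_integrable_sincD) (auto simp: mem_HO_iff)
  then have "((\<lambda>R. integral {-R..R} (\<lambda>x. F (of_real x) * sincD \<sigma> (of_real x - w)))
      \<longlongrightarrow> (LINT x|lborel. F (complex_of_real x) * sincD \<sigma> (of_real x - w))) at_top"
    by (rule tendsto_integral_symmetric)
  ultimately show ?thesis using tendsto_unique trivial_limit_at_top_linorder by blast
qed

theorem Paley_Wiener_reproducing_formula:
  assumes F_in_HO: "F \<in> HO D" and "D \<ge> 0"
  shows "(LINT x|lborel. F (complex_of_real x) * sincD D (of_real x - w)) = F w"
proof -
  have F_L2: "square_integrable lborel (\<lambda>x. F (complex_of_real x))"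
    using F_in_HO by (simp add: mem_HO_iff)
  define \<sigma> where "\<sigma> = (\<lambda>n. D + 1 / real (Suc n))"
  have \<sigma>_bounds: "D < \<sigma> n" "\<sigma> n \<le> D + 1" for n by (simp_all add: \<sigma>_def)
  have "\<sigma> \<longlonglongrightarrow> D" unfolding \<sigma>_def by real_asymp
  define K where "K = (D + 2) * exp (pi * (D + 1) * \<bar>Im w\<bar>)"
  let ?f = "\<lambda>\<sigma> x. F (complex_of_real x) * sincD \<sigma> (of_real x - w)"
  have integrable_f: "integrable lborel (?f \<sigma>)" if "\<sigma> \<ge> 0" for \<sigma>
    by (rule integrable_mult_square_integrable[OF F_L2 square_integrable_sincD[OF that]])
  have "(\<lambda>n. LINT x|lborel. ?f (\<sigma> n) x) \<longlonglongrightarrow> (LINT x|lborel. ?f D x)"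
  proof (rule integral_dominated_convergence)
    show "?f D \<in> borel_measurable lborel"
      using integrable_f[OF \<open>D \<ge> 0\<close>] by simp
    show "?f (\<sigma> n) \<in> borel_measurable lborel" for n
      using integrable_f[of "\<sigma> n"] \<sigma>_bounds[of n] \<open>D \<ge> 0\<close> by simp
    have "square_integrable lborel (\<lambda>x. norm (F (complex_of_real x)))"
      using F_L2 by (auto simp: square_integrable_def)
    then show "integrable lborel
        (\<lambda>x. norm (F (complex_of_real x)) * (1 / (1 + norm (complex_of_real x - w))) * K)"
      by (intro integrable_mult_left integrable_mult_square_integrable
          square_integrable_inverse_one_plus_norm)
    show "AE x in lborel. (\<lambda>n. ?f (\<sigma> n) x) \<longlonglongrightarrow> ?f D x"
      by (intro AE_I2 tendsto_intros tendsto_sincD \<open>\<sigma> \<longlonglongrightarrow> D\<close>)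
    have "norm (sincD (\<sigma> n) (of_real x - w)) \<le> 1 / (1 + norm (complex_of_real x - w)) * K" for n x
      using norm_sincD_decay[of "\<sigma> n" "D + 1" "of_real x - w"] \<sigma>_bounds[of n] \<open>D \<ge> 0\<close>
      by (simp add: K_def add.assoc)
    then show "AE x in lborel. norm (?f (\<sigma> n) x)
        \<le> norm (F (complex_of_real x)) * (1 / (1 + norm (complex_of_real x - w))) * K" for n
      unfolding norm_mult mult.assoc by (intro AE_I2 mult_left_mono) auto
  qed
  moreover have "(LINT x|lborel. ?f (\<sigma> n) x) = F w" for n
    by (rule reproducing_formula_larger_type[OF F_in_HO \<open>D \<ge> 0\<close> \<sigma>_bounds(1)])
  ultimately show ?thesis by (simp add: LIMSEQ_const_iff)
qed

subsection \<open>The kernel of the space with point mass\<close>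

lemma HO_inner_cnj: "cnj (HO_inner F G) = HO_inner G F"
proof -
  have "cnj (LINT x|lborel. F (complex_of_real x) * cnj (G (of_real x)))
      = (LINT x|lborel. cnj (F (complex_of_real x) * cnj (G (of_real x))))"
    by (rule Bochner_Integration.integral_cnj[symmetric])
  then show ?thesis by (simp add: HO_inner_def mult_ac)
qed

lemma integrable_HO_inner:
  assumes "F \<in> HO D" "G \<in> HO D"
  shows "integrable lborel (\<lambda>x. F (complex_of_real x) * cnj (G (of_real x)))"
  using assms
  by (intro integrable_mult_square_integrable square_integrable_cnj) (auto simp: mem_HO_iff)

lemma HO_inner_diff_scale_right:
  assumes "F \<in> HO D" "G \<in> HO D" "H \<in> HO D"
  shows "HO_inner F (\<lambda>z. G z - c * H z) = HO_inner F G - cnj c * HO_inner F H"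
proof -
  have "F (of_real x) * cnj (G (of_real x) - c * H (of_real x))
      = F (of_real x) * cnj (G (of_real x)) - cnj c * (F (of_real x) * cnj (H (of_real x)))"
    for x :: real
    by (simp add: algebra_simps)
  then show ?thesis
    using integrable_HO_inner[OF assms(1,2)] integrable_HO_inner[OF assms(1,3)]
    by (simp add: HO_inner_def algebra_simps)
qed

lemma HO_inner_sincD:
  assumes "F \<in> HO D" "D \<ge> 0"
  shows "HO_inner F (\<lambda>z. sincD D (z - cnj w)) = F w + 1 / 2 * F 0 * sincD D w"
  using Paley_Wiener_reproducing_formula[OF assms, of w] sincD_minus[of D w]
  by (simp add: HO_inner_def cnj_sincD)

text \<open>Two kernels agree because each is the conjugate transpose of the other.\<close>

lemma reproducing_kernel_unique:
  assumes "\<And>w. K w \<in> HO D" "\<And>w F. F \<in> HO D \<Longrightarrow> F w = HO_inner F (K w)"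
    and "\<And>w. L w \<in> HO D" "\<And>w F. F \<in> HO D \<Longrightarrow> F w = HO_inner F (L w)"
  shows "K = L"
proof (intro ext)
  fix w z
  have "K w z = HO_inner (K w) (L z)" by (rule assms(4)[OF assms(1)])
  also have "\<dots> = cnj (HO_inner (L z) (K w))" by (rule HO_inner_cnj[symmetric])
  also have "\<dots> = cnj (HO_inner (L z) (L w))"
    by (simp only: assms(2)[OF assms(3), symmetric] assms(4)[OF assms(3), symmetric])
  also have "\<dots> = HO_inner (L w) (L z)" by (rule HO_inner_cnj)
  also have "\<dots> = L w z" by (rule assms(4)[OF assms(3), symmetric])
  finally show "K w z = L w z" .
qed

lemma KO_eqI:
  assumes "\<And>w. K w \<in> HO D" "\<And>w F. F \<in> HO D \<Longrightarrow> F w = HO_inner F (K w)"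
  shows "KO D = K"
  unfolding KO_def
proof (rule the_equality)
  show "(\<forall>w. K w \<in> HO D) \<and> (\<forall>w. \<forall>F\<in>HO D. F w = HO_inner F (K w))"
    using assms by blast
  show "L = K" if "(\<forall>w. L w \<in> HO D) \<and> (\<forall>w. \<forall>F\<in>HO D. F w = HO_inner F (L w))" for L
    using that by (intro reproducing_kernel_unique[OF _ _ assms]) auto
qed

definition HO_kernel :: "real \<Rightarrow> complex \<Rightarrow> complex \<Rightarrow> complex" where
  "HO_kernel D w z = sincD D (z - cnj w) - 1 / (2 + of_real D) * sincD D z * sincD D (cnj w)"

lemma HO_kernel_eq_diff_scale:
  "HO_kernel D w =
    (\<lambda>z. sincD D (z - cnj w) - sincD D (cnj w) / (2 + of_real D) * sincD D (z - cnj 0))"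
  by (simp add: HO_kernel_def fun_eq_iff)

lemma HO_kernel_mem_HO: "D \<ge> 0 \<Longrightarrow> HO_kernel D w \<in> HO D"
  unfolding HO_kernel_eq_diff_scale by (intro HO_diff HO_scale sincD_mem_HO)

lemma HO_inner_HO_kernel:
  assumes F_in_HO: "F \<in> HO D" and "D \<ge> 0"
  shows "HO_inner F (HO_kernel D w) = F w"
proof -
  define c where "c = sincD D w / (2 + of_real D)"
  have "2 + complex_of_real D \<noteq> 0" using assms by (simp add: complex_eq_iff)
  then have sincD_w: "sincD D w = c * (2 + of_real D)" by (simp add: c_def)
  have c_eq_cnj: "c = cnj (sincD D (cnj w) / (2 + of_real D))" by (simp add: c_def cnj_sincD)
  have "HO_inner F (HO_kernel D w) = HO_inner F (\<lambda>z. sincD D (z - cnj w))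
      - c * HO_inner F (\<lambda>z. sincD D (z - cnj 0))"
    unfolding HO_kernel_eq_diff_scale c_eq_cnj
    by (rule HO_inner_diff_scale_right[OF F_in_HO sincD_mem_HO sincD_mem_HO]; fact)
  also have "\<dots> = F w + 1 / 2 * F 0 * sincD D w - c * (F 0 + 1 / 2 * F 0 * of_real D)"
    unfolding HO_inner_sincD[OF assms] by (simp add: sincD_def[of _ 0])
  also have "\<dots> = F w"
    by (simp add: sincD_w algebra_simps)
  finally show ?thesis .
qed

theorem theorem4:
  fixes Delta :: real and w z :: complex
  assumes "Delta > 0"
  shows "KO Delta w z = sincD Delta (z - cnj w)
           - 1 / (2 + complex_of_real Delta) * sincD Delta z * sincD Delta (cnj w)"
proof -
  have "KO Delta = HO_kernel Delta"
    using assms by (intro KO_eqI) (simp_all add: HO_kernel_mem_HO HO_inner_HO_kernel)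
  then show ?thesis by (simp add: HO_kernel_def)
qed

end
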